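(* Let $n\ge 1$ and let $\boldsymbol{p} > \boldsymbol{0}$ and $\boldsymbol{q} > \boldsymbol{0}$ be $n$-dimensional stochastic vectors. Then the matrix $\overline{U}$ corresponding to $(\boldsymbol{p},\boldsymbol{q})$ is an inverse $M$-matrix.
   Context: Inequalities between vectors or matrices are entrywise; $\boldsymbol{1}$ is the all-ones vector, $\boldsymbol{0}$ the zero vector. A vector $\boldsymbol{a}\in\mathbb{R}^n$ is stochastic if $\boldsymbol{a}^\top\boldsymbol{1}=1$ and $\boldsymbol{a}\ge\boldsymbol{0}$. Write $[c]^+=\max\{c,0\}$. The matrix $\overline{U}\in\mathbb{R}^{n\times n}$ corresponding to $(\boldsymbol{p},\boldsymbol{q})$ has entries $$\overline{u}_{ij}=\begin{cases}1-[1-p_i/q_i]^+, & i=j,\\ 0, & i\ne j \text{ and } \boldsymbol{p}=\boldsymbol{q},\\ \dfrac{[1-p_i/q_i]^+\,[p_j-q_j]^+}{\sum_{k=1}^n[p_k-q_k]^+}, & i\neq j\text{ and }\boldsymbol{p}\ne\boldsymbol{q}.\end{cases}$$ A $Z$-matrix is a real square matrix whose off-diagonal entries are all nonpositive. An $M$-matrix is (by the characterization used in the paper) a $Z$-matrix $A$ that is nonsingular with $A^{-1}\ge 0$ entrywise. An inverse $M$-matrix is a matrix that is the inverse of an $M$-matrix. *)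

theory Defs
  imports "HOL-Analysis.Analysis"
begin

definition pos_part :: "real \<Rightarrow> real" where
  "pos_part c = max c 0"

definition stochastic :: "real ^ 'n \<Rightarrow> bool" where
  "stochastic a \<longleftrightarrow> (\<Sum>i\<in>UNIV. a $ i) = 1 \<and> (\<forall>i. 0 \<le> a $ i)"

(* Entrywise strict positivity is spelled out: the library's strict order on
   real ^ 'n is the strict part of the componentwise order, so 0 < a would only say
   that a is nonnegative and not zero. *)
definition pos_vec :: "real ^ 'n \<Rightarrow> bool" where
  "pos_vec a \<longleftrightarrow> (\<forall>i. 0 < a $ i)"

definition U_bar :: "real ^ 'n \<Rightarrow> real ^ 'n \<Rightarrow> real ^ 'n ^ 'n" where
  "U_bar p q = (\<chi> i j.
     if i = j then 1 - pos_part (1 - p $ i / q $ i)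
     else if p = q then 0
     else pos_part (1 - p $ i / q $ i) * pos_part (p $ j - q $ j)
          / (\<Sum>k\<in>UNIV. pos_part (p $ k - q $ k)))"

definition Z_matrix :: "real ^ 'n ^ 'n \<Rightarrow> bool" where
  "Z_matrix A \<longleftrightarrow> (\<forall>i j. i \<noteq> j \<longrightarrow> A $ i $ j \<le> 0)"

definition M_matrix :: "real ^ 'n ^ 'n \<Rightarrow> bool" where
  "M_matrix A \<longleftrightarrow> Z_matrix A \<and> invertible A \<and> (\<forall>i j. 0 \<le> matrix_inv A $ i $ j)"

definition inverse_M_matrix :: "real ^ 'n ^ 'n \<Rightarrow> bool" where
  "inverse_M_matrix B \<longleftrightarrow> (\<exists>A. M_matrix A \<and> B = matrix_inv A)"

end

theory Submission
  imports Defs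
begin

text \<open>
  With \<open>a\<^sub>i = [1 - p\<^sub>i / q\<^sub>i]\<^sup>+\<close> and \<open>b\<^sub>j = [p\<^sub>j - q\<^sub>j]\<^sup>+ / (\<Sum>k. [p\<^sub>k - q\<^sub>k]\<^sup>+)\<close>, the matrix is a
  rank-one perturbation of a diagonal one, \<open>D + a b\<^sup>T\<close> with \<open>D = diag (1 - a)\<close>. The reason is that
  \<open>a\<close> and \<open>b\<close> are nonnegative vectors with disjoint supports (\<open>p\<^sub>i < q\<^sub>i\<close> on the first, \<open>p\<^sub>i > q\<^sub>i\<close>
  on the second), so that \<open>a b\<^sup>T\<close> vanishes on the diagonal.

  Disjointness of the supports also gives \<open>b\<^sup>T D\<^sup>-\<^sup>1 a = 0\<close>, so the Sherman-Morrison formula for the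
  inverse has denominator 1: the inverse is \<open>D\<^sup>-\<^sup>1 - (D\<^sup>-\<^sup>1 a) (D\<^sup>-\<^sup>1 b)\<^sup>T\<close>. Since \<open>D\<close> has a positive
  diagonal, the off-diagonal entries of this matrix are visibly nonpositive, and its own inverse
  \<open>D + a b\<^sup>T\<close> is nonnegative.
\<close>

definition diag_plus_outer :: "real ^ 'n \<Rightarrow> real ^ 'n \<Rightarrow> real ^ 'n \<Rightarrow> real ^ 'n ^ 'n" where
  "diag_plus_outer d a b = (\<chi> i j. (if i = j then d $ i else 0) + a $ i * b $ j)"

text \<open>
  The Sherman-Morrison formula in the case of denominator 1. Every term of the cross product
  \<open>b\<^sup>T D\<^sup>-\<^sup>1 a\<close> vanishes, and the two remaining rank-one terms cancel.
\<close>

lemma diag_plus_outer_right_inverse: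
  fixes d a b :: "real ^ 'n"
  assumes d: "\<And>i. d $ i \<noteq> 0" and ab: "\<And>i. a $ i * b $ i = 0"
  shows "diag_plus_outer d a b **
    diag_plus_outer (\<chi> i. 1 / d $ i) (\<chi> i. - (a $ i / d $ i)) (\<chi> i. b $ i / d $ i) = mat 1"
proof -
  have "(\<Sum>k\<in>UNIV. ((if i = k then d $ i else 0) + a $ i * b $ k) *
          ((if k = j then 1 / d $ k else 0) + - (a $ k / d $ k) * (b $ j / d $ j)))
        = (if i = j then 1 else 0)" for i j
  proof -
    have "((if i = k then d $ i else 0) + a $ i * b $ k) *
          ((if k = j then 1 / d $ k else 0) + - (a $ k / d $ k) * (b $ j / d $ j))
        = (if i = k then (if i = j then 1 else 0) - a $ i * b $ j / d $ j else 0)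
          + (if k = j then a $ i * b $ j / d $ j else 0)" for k
      using d[of i] d[of k] d[of j] ab[of k] by (auto simp: field_simps)
    then show ?thesis
      by (simp add: sum.distrib)
  qed
  then show ?thesis
    unfolding diag_plus_outer_def matrix_matrix_mult_def mat_def vec_eq_iff
    by (simp only: vec_lambda_beta) blast
qed

lemma matrix_inv_eqI:
  fixes A B :: "real ^ 'n ^ 'n"
  assumes "A ** B = mat 1"
  shows "matrix_inv A = B"
proof -
  have BA: "B ** A = mat 1"
    using assms by (rule iffD1[OF matrix_left_right_inverse])
  have "A ** matrix_inv A = mat 1 \<and> matrix_inv A ** A = mat 1"
    unfolding matrix_inv_def
    by (rule someI[where P = "\<lambda>X. A ** X = mat 1 \<and> X ** A = mat 1" and x = B]) (simp add: assms BA)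
  then have "B ** (A ** matrix_inv A) = B"
    by simp
  then show ?thesis
    by (simp add: matrix_mul_assoc BA)
qed

lemma inverse_M_matrix_diag_plus_outer:
  fixes d a b :: "real ^ 'n"
  assumes d: "\<And>i. 0 < d $ i" and a: "\<And>i. 0 \<le> a $ i" and b: "\<And>i. 0 \<le> b $ i"
    and ab: "\<And>i. a $ i * b $ i = 0"
  shows "inverse_M_matrix (diag_plus_outer d a b)"
proof -
  let ?U = "diag_plus_outer d a b"
  let ?A = "diag_plus_outer (\<chi> i. 1 / d $ i) (\<chi> i. - (a $ i / d $ i)) (\<chi> i. b $ i / d $ i)"
  have UA: "?U ** ?A = mat 1"
    using d ab by (intro diag_plus_outer_right_inverse) (metis less_irrefl, blast)
  then have AU: "?A ** ?U = mat 1"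
    by (rule iffD1[OF matrix_left_right_inverse])
  then have inv: "matrix_inv ?A = ?U"
    by (rule matrix_inv_eqI)
  have "Z_matrix ?A"
    using d a b by (simp add: Z_matrix_def diag_plus_outer_def less_imp_le)
  moreover have "invertible ?A"
    unfolding invertible_def using UA AU by blast
  moreover have "0 \<le> ?U $ i $ j" for i j
    using d a b by (simp add: diag_plus_outer_def less_imp_le)
  ultimately have "M_matrix ?A"
    unfolding M_matrix_def inv by blast
  then show ?thesis
    unfolding inverse_M_matrix_def using inv[symmetric] by blast
qed

theorem corollary12:
  fixes p q :: "real ^ 'n"
  assumes "stochastic p" and "stochastic q"
    and "pos_vec p" and "pos_vec q"
  shows "inverse_M_matrix (U_bar p q)"
proof -
  have p: "0 < p $ i" and q: "0 < q $ i" for i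
    using assms by (auto simp: pos_vec_def)
  define a :: "real ^ 'n" where "a = (\<chi> i. pos_part (1 - p $ i / q $ i))"
  define b :: "real ^ 'n" where
    "b = (\<chi> j. pos_part (p $ j - q $ j) / (\<Sum>k\<in>UNIV. pos_part (p $ k - q $ k)))"
  have a_nonneg: "0 \<le> a $ i" for i
    by (simp add: a_def pos_part_def)
  have a_less: "a $ i < 1" for i
    using p[of i] q[of i] by (simp add: a_def pos_part_def)
  have b_nonneg: "0 \<le> b $ i" for i
    by (simp add: b_def pos_part_def sum_nonneg)
  have ab: "a $ i * b $ i = 0" for i
  proof (cases "p $ i \<le> q $ i")
    case True
    then show ?thesis by (simp add: b_def pos_part_def)
  next
    case False
    then show ?thesis using q[of i] by (simp add: a_def pos_part_def)
  qed
  \<comment> \<open>If \<open>p = q\<close> then \<open>a = 0\<close>, so the formula for the other case gives the zero off-diagonal entries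
     of this case as well.\<close>
  have a_zero: "a $ i = 0" if "p = q" for i
    using that q[of i] by (simp add: a_def pos_part_def)
  have "U_bar p q $ i $ j = diag_plus_outer (\<chi> i. 1 - a $ i) a b $ i $ j" for i j
  proof (cases "i = j")
    case True
    then show ?thesis using ab[of j] by (simp add: U_bar_def diag_plus_outer_def a_def)
  next
    case False
    then show ?thesis
      using a_zero[of i] by (simp add: U_bar_def diag_plus_outer_def) (simp add: a_def b_def)
  qed
  then have "U_bar p q = diag_plus_outer (\<chi> i. 1 - a $ i) a b"
    by (simp add: vec_eq_iff)
  then show ?thesis
    using inverse_M_matrix_diag_plus_outer[of "\<chi> i. 1 - a $ i" a b] a_nonneg a_less b_nonneg ab
    by simp
qed

end
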